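(* Let $\nu>0$ and $u,v\in D\setminus\{0\}$, where $D=\{z\in\mathbb{C}:|z|<1\}$. Let $f\in L^2_\nu(\mathbb{C})$ and let $g_k$, $k\in\mathbb{Z}$, be its angular Fourier coefficients, so that $f(re^{i\theta})=\sum_{k\in\mathbb{Z}}g_k(r)e^{ik\theta}$. Then the functions $\mathcal{H}^{\nu,k}_{u,v}(g_k)$, $k\in\mathbb{Z}$, are the angular Fourier coefficients of the fractional Fourier transform $\mathcal{F}^\nu_{u,v}f$; that is, if $\mathcal{F}^\nu_{u,v}f(\rho e^{i\varphi})=\sum_{k\in\mathbb{Z}}G_k(\rho)e^{ik\varphi}$, then $G_k(\rho)=\mathcal{H}^{\nu,k}_{u,v}(g_k)(\rho)$ for every $k\in\mathbb{Z}$.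
   Context: $L^2_\nu(\mathbb{C})=L^2(\mathbb{C};e^{-\nu|z|^2}d\lambda)$ with $d\lambda$ Lebesgue measure. The angular Fourier coefficients of $f$ are $g_k(r)=\frac1{2\pi}\int_0^{2\pi}f(re^{i\theta})e^{-ik\theta}d\theta$, and similarly $G_k$ for $\mathcal{F}^\nu_{u,v}f$. The 2d fractional Fourier transform is $$\mathcal{F}^\nu_{u,v}\psi(\xi)=\int_{\mathbb{C}}\psi(\zeta)K^\nu_{u,v}(\zeta;\xi)e^{-\nu|\zeta|^2}d\lambda(\zeta),\qquad \xi\in\mathbb{C},$$ $$K^\nu_{u,v}(\zeta;\xi)=\frac{\nu}{\pi(1-uv)}\exp\left(\frac{\nu}{1-uv}\left\{-uv(|\zeta|^2+|\xi|^2)+u\overline{\zeta}\xi+v\zeta\overline{\xi}\right\}\right).$$ The fractional Hankel transform of integer order $k$ is $$\mathcal{H}^{\nu,k}_{u,v}(g)(y)=\frac{2\nu}{1-uv}\left(\frac{u}{v}\right)^{k/2}\int_0^\infty x\,g(x)\,I_k\left(\frac{2\nu\sqrt{uv}}{1-uv}xy\right)e^{-\nu(x^2+uvy^2)/(1-uv)}\,dx,$$ where $I_k(\xi)=\sum_{n=0}^\infty\frac{1}{n!\,\Gamma(k+n+1)}\left(\frac{\xi}{2}\right)^{2n+k}$ is the modified Bessel function (with $1/\Gamma$ vanishing at non-positive integers), and the square roots are chosen consistently: $(u/v)^{k/2}=((u/v)^{1/2})^k$ with $(u/v)^{1/2}\sqrt{uv}=u$. *)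

theory Defs
  imports "HOL-Analysis.Analysis"
begin

text \<open>
  Elements of the weighted space \<open>L\<^sup>2(\<complex>, exp (-\<nu>|z|\<^sup>2) d\<lambda>)\<close> are represented by Lebesgue measurable
  functions, not by equivalence classes modulo null sets.
\<close>

definition L2_gauss :: "real \<Rightarrow> (complex \<Rightarrow> complex) set" where
  "L2_gauss \<nu> = {f. f \<in> borel_measurable lebesgue \<and>
     integrable lebesgue (\<lambda>z. (cmod (f z))\<^sup>2 * exp (- \<nu> * (cmod z)\<^sup>2))}"

definition angular_coeff :: "(complex \<Rightarrow> complex) \<Rightarrow> int \<Rightarrow> real \<Rightarrow> complex" where
  "angular_coeff f k r =
     1 / (2 * pi) * (LINT \<theta>:{0..2 * pi}|lebesgue. f (rcis r \<theta>) * cis (- (of_int k * \<theta>)))"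

definition frft_kernel ::
    "real \<Rightarrow> complex \<Rightarrow> complex \<Rightarrow> complex \<Rightarrow> complex \<Rightarrow> complex" where
  "frft_kernel \<nu> u v \<zeta> \<xi> =
     of_real \<nu> / (of_real pi * (1 - u * v)) *
     exp (of_real \<nu> / (1 - u * v) *
       (- (u * v) * of_real ((cmod \<zeta>)\<^sup>2 + (cmod \<xi>)\<^sup>2) + u * cnj \<zeta> * \<xi> + v * \<zeta> * cnj \<xi>))"

definition frft ::
    "real \<Rightarrow> complex \<Rightarrow> complex \<Rightarrow> (complex \<Rightarrow> complex) \<Rightarrow> complex \<Rightarrow> complex" where
  "frft \<nu> u v f \<xi> =
     (LINT \<zeta>|lebesgue. f \<zeta> * frft_kernel \<nu> u v \<zeta> \<xi> * of_real (exp (- \<nu> * (cmod \<zeta>)\<^sup>2)))"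

text \<open>
  The reciprocal Gamma function \<open>rGamma\<close> is entire and vanishes at the non-positive integers,
  so the terms with a negative exponent, which occur for \<open>k < 0\<close>, are zero.
\<close>

definition bessel_I :: "int \<Rightarrow> complex \<Rightarrow> complex" where
  "bessel_I k z =
     (\<Sum>n. rGamma (of_int (k + int n + 1)) / fact n * (z / 2) powi (2 * int n + k))"

text \<open>
  The arguments \<open>s\<close> and \<open>t\<close> stand for the square roots \<open>(u/v)\<^sup>1\<^sup>/\<^sup>2\<close> and \<open>(uv)\<^sup>1\<^sup>/\<^sup>2\<close>; the transform is
  meaningful for a consistent choice of them.  As \<open>bessel_I k (-z) = (-1)\<^sup>k bessel_I k z\<close>, the two
  consistent choices \<open>(s, t)\<close> and \<open>(-s, -t)\<close> give the same transform.
\<close>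

definition consistent_roots :: "complex \<Rightarrow> complex \<Rightarrow> complex \<Rightarrow> complex \<Rightarrow> bool" where
  "consistent_roots u v s t \<longleftrightarrow> s\<^sup>2 = u / v \<and> t\<^sup>2 = u * v \<and> s * t = u"

definition frac_hankel ::
    "real \<Rightarrow> int \<Rightarrow> complex \<Rightarrow> complex \<Rightarrow> complex \<Rightarrow> complex \<Rightarrow> (real \<Rightarrow> complex) \<Rightarrow> real \<Rightarrow> complex"
  where
  "frac_hankel \<nu> k u v s t g y =
     2 * of_real \<nu> / (1 - u * v) * s powi k *
     (LINT x:{0..}|lebesgue.
        of_real x * g x * bessel_I k (2 * of_real \<nu> * t / (1 - u * v) * of_real x * of_real y) *
        exp (- of_real \<nu> * (of_real (x\<^sup>2) + u * v * of_real (y\<^sup>2)) / (1 - u * v)))"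

end

theory Submission
  imports Defs
begin

text \<open>
  Restricted to the circle \<open>\<xi> = \<rho> cis \<phi>\<close>, the kernel at \<open>\<zeta> = r cis \<theta>\<close> depends on \<open>\<phi>\<close> only through
  \<open>exp (A cis \<phi> + B cis (-\<phi>))\<close> with \<open>A\<close> and \<open>B\<close> proportional to \<open>u r \<rho> cis (-\<theta>)\<close> and
  \<open>v r \<rho> cis \<theta>\<close>. This is the generating function of the modified Bessel functions, so its \<open>k\<close>-th Fourier
  coefficient in \<open>\<phi>\<close> is, up to a constant, \<open>cis (-k \<theta>)\<close> times the Bessel function of order \<open>k\<close> at a
  multiple of \<open>r \<rho>\<close> (lemma \<open>integral_circle_bessel_I\<close>). Taking the \<open>k\<close>-th angular coefficient of the transform under the
  integral over \<open>\<zeta>\<close>, and then passing to polar coordinates in \<open>\<zeta>\<close>, the phase \<open>cis (-k \<theta>)\<close> turns the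
  inner integral over \<open>\<theta>\<close> into the \<open>k\<close>-th angular coefficient of \<open>f\<close>. What is left is the radial
  integral that defines the Hankel transform.

  The exchange of the integrals over \<open>\<zeta>\<close> and \<open>\<phi>\<close> is legitimate because the weighted kernel is, uniformly
  in \<open>\<phi>\<close>, dominated by \<open>exp (- \<nu> |\<zeta>|\<^sup>2 / 2)\<close> times a Gaussian (lemma
  \<open>frft_kernel_gaussian_bound\<close>), and \<open>f exp (- \<nu> |\<zeta>|\<^sup>2 / 2)\<close> is square integrable.

  Polar coordinates (lemmas \<open>nn_integral_polar\<close> and \<open>integral_polar\<close>) are obtained without the
  Jacobian: Lebesgue measure is invariant under rotations, and the area of a disc determines the
  distribution of the modulus. They hold for Borel functions. A Lebesgue measurable \<open>f\<close> is
  replaced by a Borel function that agrees with it almost everywhere, which affects its angular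
  coefficients only at a null set of radii (lemma \<open>angular_coeff_AE_eq\<close>).
\<close>

section \<open>Polar coordinates in the complex plane\<close>

lemma lborel_complex_eq_distr:
  "lborel = distr (lborel \<Otimes>\<^sub>M lborel) borel (\<lambda>(x, y). Complex x y)"
proof (rule lborel_eqI)
  have m: "(\<lambda>p. Complex (fst p) (snd p)) \<in> borel_measurable (lborel \<Otimes>\<^sub>M lborel)"
    unfolding Complex_eq by measurable
  fix l u :: complex
  assume *: "\<And>b. b \<in> Basis \<Longrightarrow> l \<bullet> b \<le> u \<bullet> b"
  have le: "Re l \<le> Re u" "Im l \<le> Im u"
    using *[of 1] *[of \<i>] by (auto simp: Basis_complex_def)
  have "(\<lambda>(x, y). Complex x y) -` box l u = {Re l<..<Re u} \<times> {Im l<..<Im u}"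
    by (auto simp: box_def Basis_complex_def)
  then show "emeasure (distr (lborel \<Otimes>\<^sub>M lborel) borel (\<lambda>(x, y). Complex x y)) (box l u) =
      (\<Prod>b\<in>Basis. (u - l) \<bullet> b)"
    using m le
    by (simp add: emeasure_distr case_prod_beta' space_pair_measure
        lborel.emeasure_pair_measure_Times Basis_complex_def ennreal_mult)
qed simp

lemma borel_measurable_Complex [measurable (raw)]:
  assumes "f \<in> borel_measurable M" "g \<in> borel_measurable M"
  shows "(\<lambda>x. Complex (f x) (g x)) \<in> borel_measurable M"
  using assms unfolding Complex_eq by measurable

lemma nn_integral_lborel_complex:
  assumes [measurable]: "h \<in> borel_measurable borel"
  shows "(\<integral>\<^sup>+z. h z \<partial>lborel) = (\<integral>\<^sup>+x. \<integral>\<^sup>+y. h (Complex x y) \<partial>lborel \<partial>lborel)"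
proof -
  have "(\<integral>\<^sup>+z. h z \<partial>lborel) = (\<integral>\<^sup>+p. h (Complex (fst p) (snd p)) \<partial>(lborel \<Otimes>\<^sub>M lborel))"
    by (subst lborel_complex_eq_distr, subst nn_integral_distr) (simp_all add: case_prod_beta')
  also have "\<dots> = (\<integral>\<^sup>+x. \<integral>\<^sup>+y. h (Complex x y) \<partial>lborel \<partial>lborel)"
    by (subst lborel.nn_integral_fst [symmetric]) simp_all
  finally show ?thesis .
qed

lemma nn_integral_lborel_shift:
  fixes c :: real
  assumes "f \<in> borel_measurable borel"
  shows "(\<integral>\<^sup>+x. f (x + c) \<partial>lborel) = (\<integral>\<^sup>+x. f x \<partial>lborel)"
  using nn_integral_real_affine[of f 1 c] assms by (simp add: add.commute)

lemma nn_integral_lborel_shear_Im: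
  fixes c :: real
  assumes [measurable]: "h \<in> borel_measurable borel"
  shows "(\<integral>\<^sup>+z. h (Complex (Re z) (Im z + c * Re z)) \<partial>lborel) = (\<integral>\<^sup>+z. h z \<partial>lborel)"
  by (simp add: nn_integral_lborel_complex nn_integral_lborel_shift[of "\<lambda>y. h (Complex _ y)"])

lemma nn_integral_lborel_shear_Re:
  fixes c :: real
  assumes [measurable]: "h \<in> borel_measurable borel"
  shows "(\<integral>\<^sup>+z. h (Complex (Re z + c * Im z) (Im z)) \<partial>lborel) = (\<integral>\<^sup>+z. h z \<partial>lborel)"
proof -
  have "(\<integral>\<^sup>+z. h (Complex (Re z + c * Im z) (Im z)) \<partial>lborel)
      = (\<integral>\<^sup>+y. \<integral>\<^sup>+x. h (Complex (x + c * y) y) \<partial>lborel \<partial>lborel)"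
    by (subst nn_integral_lborel_complex, simp, simp, rule lborel_pair.Fubini' [symmetric]) simp
  also have "\<dots> = (\<integral>\<^sup>+y. \<integral>\<^sup>+x. h (Complex x y) \<partial>lborel \<partial>lborel)"
    by (simp add: nn_integral_lborel_shift[of "\<lambda>x. h (Complex x _)"])
  also have "\<dots> = (\<integral>\<^sup>+z. h z \<partial>lborel)"
    by (subst nn_integral_lborel_complex, simp, rule lborel_pair.Fubini') simp
  finally show ?thesis .
qed

text \<open>
  A rotation by an angle other than \<open>\<pi>\<close> is a product of three shears, horizontal, vertical and
  horizontal again. A shear preserves area because, in each line parallel to its axis, it is a translation.
\<close>

lemma nn_integral_lborel_rotate:
  fixes w :: complex
  assumes [measurable]: "h \<in> borel_measurable borel" and w: "cmod w = 1"
  shows "(\<integral>\<^sup>+z. h (w * z) \<partial>lborel) = (\<integral>\<^sup>+z. h z \<partial>lborel)"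
proof -
  have *: "(\<integral>\<^sup>+z. g (w * z) \<partial>lborel) = (\<integral>\<^sup>+z. g z \<partial>lborel)"
    if [measurable]: "g \<in> borel_measurable borel" and w: "cmod w = 1" "w \<noteq> -1" for w and g :: "complex \<Rightarrow> ennreal"
  proof -
    \<comment> \<open>For \<open>w = cis \<theta>\<close> the shear factors are \<open>a = - tan (\<theta> / 2)\<close> and \<open>b = sin \<theta>\<close>.\<close>
    define a where "a = - Im w / (1 + Re w)"
    define b where "b = Im w"
    have sq: "(Re w)\<^sup>2 + (Im w)\<^sup>2 = 1"
      using w(1) by (simp add: cmod_def)
    have "Re w \<noteq> -1"
      using w(2) sq by (auto simp: complex_eq_iff)
    then have ne: "1 + Re w \<noteq> 0" by auto
    have ab: "1 + a * b = Re w" "a * (1 + Re w) = - b"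
      using ne sq by (auto simp: a_def b_def field_simps power2_eq_square)
    define P where "P = (\<lambda>z. Complex (Re z + a * Im z) (Im z))"
    define Q where "Q = (\<lambda>z. Complex (Re z) (Im z + b * Re z))"
    have [measurable]: "P \<in> borel_measurable borel" "Q \<in> borel_measurable borel"
      unfolding P_def Q_def by measurable
    have "w * z = P (Q (P z))" for z
    proof (rule complex_eqI)
      have "Re (P (Q (P z))) = Re z * (1 + a * b) + Im z * (a * (1 + (1 + a * b)))"
        by (simp add: P_def Q_def algebra_simps)
      then show "Re (w * z) = Re (P (Q (P z)))" by (simp only: ab) (simp add: b_def)
      have "Im (P (Q (P z))) = Im z * (1 + a * b) + Re z * b"
        by (simp add: P_def Q_def algebra_simps)
      then show "Im (w * z) = Im (P (Q (P z)))" by (simp only: ab) (simp add: b_def)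
    qed
    then have "(\<integral>\<^sup>+z. g (w * z) \<partial>lborel) = (\<integral>\<^sup>+z. (\<lambda>z. g (P (Q z))) (P z) \<partial>lborel)"
      by simp
    also have "\<dots> = (\<integral>\<^sup>+z. (\<lambda>z. g (P z)) (Q z) \<partial>lborel)"
      unfolding P_def by (subst nn_integral_lborel_shear_Re) simp_all
    also have "\<dots> = (\<integral>\<^sup>+z. g (P z) \<partial>lborel)"
      unfolding Q_def by (subst nn_integral_lborel_shear_Im) simp_all
    also have "\<dots> = (\<integral>\<^sup>+z. g z \<partial>lborel)"
      unfolding P_def by (subst nn_integral_lborel_shear_Re) simp_all
    finally show ?thesis .
  qed
  \<comment> \<open>The rotation by \<open>\<pi>\<close> is the square of the rotation by \<open>\<pi> / 2\<close>.\<close>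
  show ?thesis
  proof (cases "w = -1")
    case True
    have "(\<integral>\<^sup>+z. h (w * z) \<partial>lborel) = (\<integral>\<^sup>+z. (\<lambda>z. h (\<i> * z)) (\<i> * z) \<partial>lborel)"
      by (simp add: True flip: mult.assoc)
    also have "\<dots> = (\<integral>\<^sup>+z. h (\<i> * z) \<partial>lborel)"
      by (rule *) (auto simp: complex_eq_iff)
    also have "\<dots> = (\<integral>\<^sup>+z. h z \<partial>lborel)"
      by (rule *) (auto simp: complex_eq_iff)
    finally show ?thesis .
  qed (use * w in simp)
qed

text \<open>
  Both sides give the half-line up to \<open>a \<ge> 0\<close> the area \<open>\<pi> a\<^sup>2\<close> of a disc. The density needs no restriction
  to \<open>r \<ge> 0\<close>, since \<open>ennreal\<close> sends negative reals to \<open>0\<close>.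
\<close>

lemma distr_cmod_lborel:
  "distr lborel borel cmod = density lborel (\<lambda>r. ennreal (2 * pi * r))"
proof (rule measure_eqI_generator_eq)
  have eq: "emeasure (distr lborel borel cmod) {..a} = ennreal (if a < 0 then 0 else pi * a\<^sup>2)" for a :: real
  proof -
    have "cmod -` {..a} = cball 0 a" by auto
    then show ?thesis
      by (simp add: emeasure_distr emeasure_cball unit_ball_vol_2)
  qed
  have eq2: "emeasure (density lborel (\<lambda>r. ennreal (2 * pi * r))) {..a} = ennreal (if a < 0 then 0 else pi * a\<^sup>2)" for a :: real
  proof (cases "a < 0")
    case True
    have "(\<integral>\<^sup>+x. ennreal (2 * pi * x) * indicator {..a} x \<partial>lborel) = (\<integral>\<^sup>+x. 0 \<partial>(lborel::real measure))"
      using True by (intro nn_integral_cong) (auto simp: indicator_def ennreal_neg mult_nonneg_nonpos)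
    with True show ?thesis by (simp add: emeasure_density)
  next
    case False
    have "(\<integral>\<^sup>+x. ennreal (2 * pi * x) * indicator {..a} x \<partial>lborel) = (\<integral>\<^sup>+x. ennreal (2 * pi * x) * indicator {0..a} x \<partial>lborel)"
      by (intro nn_integral_cong) (auto simp: indicator_def ennreal_neg mult_nonneg_nonpos)
    also have "\<dots> = ennreal (pi * a\<^sup>2 - pi * 0\<^sup>2)"
      using False by (intro nn_integral_FTC_Icc) (auto intro!: derivative_eq_intros)
    finally show ?thesis using False by (simp add: emeasure_density)
  qed
  show "Int_stable (range (\<lambda>a::real. {..a}))"
    by (auto simp: Int_stable_def)
  show "sets (distr lborel borel cmod) = sigma_sets UNIV (range (\<lambda>a::real. {..a}))"
    "sets (density lborel (\<lambda>r. ennreal (2 * pi * r))) = sigma_sets UNIV (range (\<lambda>a::real. {..a}))"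
    by (simp_all add: borel_eq_atMost)
  show "range (\<lambda>n::nat. {..real n}) \<subseteq> range (\<lambda>a::real. {..a})" by auto
  show "(\<Union>n. {..real n}) = UNIV"
    by (auto intro: real_arch_simple)
  show "emeasure (distr lborel borel cmod) {..real i} \<noteq> \<infinity>" for i
    unfolding eq by simp
  fix X :: "real set" assume "X \<in> range (\<lambda>a::real. {..a})"
  then show "emeasure (distr lborel borel cmod) X = emeasure (density lborel (\<lambda>r. ennreal (2 * pi * r))) X"
    using eq eq2 by auto
qed auto

lemma nn_integral_radial:
  assumes [measurable]: "g \<in> borel_measurable borel"
  shows "(\<integral>\<^sup>+z. g (cmod z) \<partial>lborel) = (\<integral>\<^sup>+r. ennreal (2 * pi * r) * g r \<partial>lborel)"
proof -
  have "(\<integral>\<^sup>+z. g (cmod z) \<partial>lborel) = (\<integral>\<^sup>+r. g r \<partial>distr lborel borel cmod)"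
    by (simp add: nn_integral_distr)
  also have "\<dots> = (\<integral>\<^sup>+r. ennreal (2 * pi * r) * g r \<partial>lborel)"
    unfolding distr_cmod_lborel by (subst nn_integral_density) auto
  finally show ?thesis .
qed

text \<open>
  The part of the shifted period that sticks out on the right is moved back by \<open>p\<close>.
\<close>

lemma nn_integral_periodic_shift:
  fixes F :: "real \<Rightarrow> ennreal"
  assumes [measurable]: "F \<in> borel_measurable borel"
    and periodic: "\<And>x. F (x + p) = F x" and \<alpha>: "0 \<le> \<alpha>" "\<alpha> \<le> p"
  shows "(\<integral>\<^sup>+x. F (x + \<alpha>) * indicator {0..<p} x \<partial>lborel) = (\<integral>\<^sup>+x. F x * indicator {0..<p} x \<partial>lborel)"
proof -
  have "(\<integral>\<^sup>+x. F (x + \<alpha>) * indicator {0..<p} x \<partial>lborel)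
     = (\<integral>\<^sup>+x. F (x + \<alpha>) * indicator {\<alpha>..<p} (x + \<alpha>) + F (x + (\<alpha> - p)) * indicator {0..<\<alpha>} (x + (\<alpha> - p)) \<partial>lborel)"
    using \<alpha> periodic[of "_ + (\<alpha> - p)"]
    by (intro nn_integral_cong) (auto simp: indicator_def algebra_simps)
  also have "\<dots> = (\<integral>\<^sup>+x. F (x + \<alpha>) * indicator {\<alpha>..<p} (x + \<alpha>) \<partial>lborel)
      + (\<integral>\<^sup>+x. F (x + (\<alpha> - p)) * indicator {0..<\<alpha>} (x + (\<alpha> - p)) \<partial>lborel)"
    by (rule nn_integral_add) simp_all
  also have "\<dots> = (\<integral>\<^sup>+x. F x * indicator {\<alpha>..<p} x \<partial>lborel) + (\<integral>\<^sup>+x. F x * indicator {0..<\<alpha>} x \<partial>lborel)"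
    by (simp add: nn_integral_lborel_shift[of "\<lambda>x. F x * indicator _ x"])
  also have "\<dots> = (\<integral>\<^sup>+x. F x * indicator {\<alpha>..<p} x + F x * indicator {0..<\<alpha>} x \<partial>lborel)"
    by (rule nn_integral_add [symmetric]) simp_all
  also have "\<dots> = (\<integral>\<^sup>+x. F x * indicator {0..<p} x \<partial>lborel)"
    using \<alpha> by (intro nn_integral_cong) (auto simp: indicator_def)
  finally show ?thesis .
qed

lemma borel_measurable_cis [measurable]: "cis \<in> borel_measurable borel"
  by (intro borel_measurable_continuous_onI continuous_intros)

lemma borel_measurable_rcis [measurable (raw)]:
  assumes "f \<in> borel_measurable M" "g \<in> borel_measurable M"
  shows "(\<lambda>x. rcis (f x) (g x)) \<in> borel_measurable M"
  using assms unfolding rcis_def by measurable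

text \<open>
  Angles carry Lebesgue measure on the closed interval, as in the definition of the angular
  coefficients. As a measure of its own, rather than an indicator function under the integral, it
  is finite and enters Fubini's theorem directly.
\<close>

definition circle :: "real measure" where
  "circle = restrict_space lborel {0..2 * pi}"

lemma space_circle [simp]: "space circle = {0..2 * pi}"
  by (simp add: circle_def space_restrict_space)

lemma measure_circle [simp]: "measure circle {0..2 * pi} = 2 * pi"
  by (simp add: circle_def measure_restrict_space)

lemma finite_measure_circle: "finite_measure circle"
  by (rule finite_measureI) (simp add: circle_def emeasure_restrict_space space_restrict_space)

interpretation circle: finite_measure circle
  by (rule finite_measure_circle)

interpretation lborel_circle: pair_sigma_finite "lborel :: 'a::euclidean_space measure" circle ..

lemma borel_measurable_circle [measurable (raw)]:
  "f \<in> borel_measurable borel \<Longrightarrow> f \<in> borel_measurable circle"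
  unfolding circle_def by (rule measurable_restrict_space1) simp

lemma borel_measurable_snd_circle [measurable]: "snd \<in> borel_measurable (M \<Otimes>\<^sub>M circle)"
  using measurable_compose[OF measurable_snd borel_measurable_circle[OF measurable_ident]]
  by (simp add: o_def cong: measurable_cong)

lemma integral_circle:
  fixes f :: "real \<Rightarrow> 'b::{banach, second_countable_topology}"
  shows "integral\<^sup>L circle f = (LINT \<theta>:{0..2*pi}|lborel. f \<theta>)"
  unfolding circle_def set_lebesgue_integral_def by (subst integral_restrict_space) simp_all

lemma nn_integral_circle:
  assumes [measurable]: "f \<in> borel_measurable borel"
  shows "(\<integral>\<^sup>+\<theta>. f \<theta> \<partial>circle) = (\<integral>\<^sup>+\<theta>. f \<theta> * indicator {0..<2*pi} \<theta> \<partial>lborel)"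
proof -
  have "(\<integral>\<^sup>+\<theta>. f \<theta> \<partial>circle) = (\<integral>\<^sup>+\<theta>. f \<theta> * indicator {0..2*pi} \<theta> \<partial>lborel)"
    by (simp add: circle_def nn_integral_restrict_space)
  also have "\<dots> = (\<integral>\<^sup>+\<theta>. f \<theta> * indicator {0..<2*pi} \<theta> \<partial>lborel)"
    using AE_lborel_singleton[of "2 * pi"]
    by (intro nn_integral_cong_AE) (auto simp: indicator_def elim!: eventually_mono)
  finally show ?thesis .
qed

text \<open>
  Averaging \<open>h\<close> over all rotations does not change its integral over the plane and makes it radial,
  and a radial function is integrated by means of the distribution of the modulus. In the proof,
  \<open>H r\<close> is \<open>2 * pi\<close> times the average over the circle of radius \<open>r\<close>.
\<close>

lemma nn_integral_polar:
  assumes [measurable]: "h \<in> borel_measurable borel"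
  shows "(\<integral>\<^sup>+z. h z \<partial>lborel) = (\<integral>\<^sup>+r. \<integral>\<^sup>+\<theta>. ennreal r * h (rcis r \<theta>) \<partial>circle \<partial>lborel)"
proof -
  define H where "H r = (\<integral>\<^sup>+\<theta>. h (rcis r \<theta>) \<partial>circle)" for r
  have [measurable]: "H \<in> borel_measurable borel"
    unfolding H_def by measurable
  have inner: "(\<integral>\<^sup>+\<theta>. h (cis \<theta> * z) \<partial>circle) = H (cmod z)" for z
  proof -
    have z: "z = rcis (cmod z) (Arg2pi z)"
      by (metis Arg2pi_eq cis_conv_exp mult.commute rcis_def)
    have "cis \<theta> * z = rcis (cmod z) (\<theta> + Arg2pi z)" for \<theta>
      by (subst (1) z) (simp add: rcis_def cis_mult[symmetric] mult_ac)
    then have "(\<integral>\<^sup>+\<theta>. h (cis \<theta> * z) \<partial>circle)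
       = (\<integral>\<^sup>+\<theta>. h (rcis (cmod z) (\<theta> + Arg2pi z)) * indicator {0..<2*pi} \<theta> \<partial>lborel)"
      by (simp add: nn_integral_circle)
    also have "\<dots> = (\<integral>\<^sup>+\<theta>. h (rcis (cmod z) \<theta>) * indicator {0..<2*pi} \<theta> \<partial>lborel)"
      using Arg2pi_ge_0[of z] Arg2pi_lt_2pi[of z]
      by (intro nn_integral_periodic_shift[of "\<lambda>x. h (rcis (cmod z) x)"])
         (auto simp: rcis_def cis_mult[symmetric])
    finally show ?thesis
      by (simp add: H_def nn_integral_circle)
  qed
  have "emeasure circle (space circle) = ennreal (2 * pi)"
    by (simp add: circle_def emeasure_restrict_space space_restrict_space)
  then have "ennreal (2 * pi) * (\<integral>\<^sup>+z. h z \<partial>lborel) = (\<integral>\<^sup>+\<theta>. (\<integral>\<^sup>+z. h z \<partial>lborel) \<partial>circle)"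
    by (simp add: mult.commute)
  also have "\<dots> = (\<integral>\<^sup>+\<theta>. \<integral>\<^sup>+z. h (cis \<theta> * z) \<partial>lborel \<partial>circle)"
    by (simp add: nn_integral_lborel_rotate)
  also have "\<dots> = (\<integral>\<^sup>+z. \<integral>\<^sup>+\<theta>. h (cis \<theta> * z) \<partial>circle \<partial>lborel)"
    by (rule lborel_circle.Fubini') measurable
  also have "\<dots> = (\<integral>\<^sup>+r. ennreal (2 * pi * r) * H r \<partial>lborel)"
    by (simp add: inner nn_integral_radial)
  also have "\<dots> = ennreal (2 * pi) * (\<integral>\<^sup>+r. ennreal r * H r \<partial>lborel)"
    by (subst nn_integral_cmult [symmetric]) (simp_all add: ennreal_mult' mult.assoc)
  also have "(\<integral>\<^sup>+r. ennreal r * H r \<partial>lborel) = (\<integral>\<^sup>+r. \<integral>\<^sup>+\<theta>. ennreal r * h (rcis r \<theta>) \<partial>circle \<partial>lborel)"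
    unfolding H_def by (simp add: nn_integral_cmult)
  finally show ?thesis
    by (simp add: ennreal_mult_cancel_left)
qed

text \<open>
  In this form, as an equality of measures, the polar formula transfers to Bochner integrals and
  to statements that hold almost everywhere.
\<close>

lemma lborel_polar:
  "lborel = distr (density (lborel \<Otimes>\<^sub>M circle) (\<lambda>p. ennreal (fst p))) borel
     (\<lambda>p. rcis (fst p) (snd p))" (is "_ = ?D")
proof (rule measure_eqI)
  fix A :: "complex set" assume "A \<in> sets lborel"
  then have [measurable]: "A \<in> sets borel" by simp
  have "emeasure ?D A = (\<integral>\<^sup>+z. indicator A z \<partial>?D)"
    by simp
  also have "\<dots> = (\<integral>\<^sup>+p. ennreal (fst p) * indicator A (rcis (fst p) (snd p)) \<partial>(lborel \<Otimes>\<^sub>M circle))"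
    by (subst nn_integral_distr) (simp_all add: nn_integral_density)
  also have "\<dots> = (\<integral>\<^sup>+r. \<integral>\<^sup>+\<theta>. ennreal r * indicator A (rcis r \<theta>) \<partial>circle \<partial>lborel)"
    by (subst circle.nn_integral_fst [symmetric]) simp_all
  also have "\<dots> = emeasure lborel A"
    by (simp flip: nn_integral_polar)
  finally show "emeasure lborel A = emeasure ?D A" ..
qed simp

lemma integral_polar:
  fixes F :: "complex \<Rightarrow> 'b::{banach, second_countable_topology}"
  assumes F: "integrable lborel F"
  shows "(LINT z|lborel. F z) = (LINT r:{0..}|lborel. r *\<^sub>R (LINT \<theta>|circle. F (rcis r \<theta>)))"
proof -
  let ?P = "lborel \<Otimes>\<^sub>M circle"
  have [measurable]: "F \<in> borel_measurable borel" using F by auto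
  have d: "density ?P (\<lambda>p. ennreal (fst p)) = density ?P (\<lambda>p. ennreal (max 0 (fst p)))"
    by (rule arg_cong[of _ _ "density ?P"]) (auto simp: max_def ennreal_neg)
  have "integrable (distr (density ?P (\<lambda>p. ennreal (fst p))) borel (\<lambda>p. rcis (fst p) (snd p))) F"
    using F by (simp only: lborel_polar [symmetric])
  then have int: "integrable ?P (\<lambda>p. max 0 (fst p) *\<^sub>R F (rcis (fst p) (snd p)))"
    by (simp add: integrable_distr_eq d integrable_density)
  have "(LINT z|lborel. F z) = (LINT p|?P. max 0 (fst p) *\<^sub>R F (rcis (fst p) (snd p)))"
    by (subst lborel_polar, subst integral_distr) (simp_all add: d integral_density)
  also have "\<dots> = (LINT r|lborel. LINT \<theta>|circle. max 0 r *\<^sub>R F (rcis r \<theta>))"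
    using lborel_circle.integral_fst'[OF int] by simp
  also have "\<dots> = (LINT r:{0..}|lborel. r *\<^sub>R (LINT \<theta>|circle. F (rcis r \<theta>)))"
    unfolding set_lebesgue_integral_def
    by (intro Bochner_Integration.integral_cong) (auto simp: indicator_def max_def)
  finally show ?thesis .
qed

lemma AE_polar:
  assumes "AE z in lborel. P z"
  shows "AE r in lborel. r > 0 \<longrightarrow> (AE \<theta> in circle. P (rcis r \<theta>))"
proof -
  let ?P = "lborel \<Otimes>\<^sub>M circle"
  from assms have "AE z in distr (density ?P (\<lambda>p. ennreal (fst p))) borel (\<lambda>p. rcis (fst p) (snd p)). P z"
    by (simp only: lborel_polar [symmetric])
  then have "AE p in density ?P (\<lambda>p. ennreal (fst p)). P (rcis (fst p) (snd p))"
    by (rule AE_distrD[rotated]) simp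
  then have "AE p in ?P. 0 < fst p \<longrightarrow> P (rcis (fst p) (snd p))"
    by (simp add: AE_density)
  from lborel_circle.AE_pair[OF this] show ?thesis
    by (auto elim!: eventually_mono)
qed

section \<open>The generating function of the modified Bessel functions\<close>

lemma integral_circle_cis:
  "integral\<^sup>L circle (\<lambda>\<theta>. cis (of_int m * \<theta>)) = (if m = 0 then 2 * pi else 0)"
proof (cases "m = 0")
  case True
  then show ?thesis
    by (simp add: integral_circle set_lebesgue_integral_def scaleR_conv_of_real)
next
  case False
  let ?F = "\<lambda>\<theta>. cis (of_int m * \<theta>) / (\<i> * of_int m)"
  have "(LINT \<theta>:{0..2*pi}|lborel. cis (of_int m * \<theta>)) = ?F (2 * pi) - ?F 0"
    unfolding set_lebesgue_integral_def
  proof (rule integral_FTC_Icc)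
    fix x :: real
    have "((\<lambda>\<theta>. cis (of_int m * \<theta>)) has_derivative (\<lambda>h. (h * of_int m) *\<^sub>R (\<i> * cis (of_int m * x)))) (at x within {0..2*pi})"
      by (auto intro!: derivative_eq_intros simp: mult.commute)
    then have "((\<lambda>\<theta>. cis (of_int m * \<theta>)) has_vector_derivative (of_int m * (\<i> * cis (of_int m * x)))) (at x within {0..2*pi})"
      unfolding has_vector_derivative_def by (simp add: scaleR_conv_of_real mult_ac)
    from has_vector_derivative_divide[OF this, of "\<i> * of_int m"] False
    show "(?F has_vector_derivative cis (of_int m * x)) (at x within {0..2*pi})"
      by simp
  next
    show "continuous_on {0..2*pi} (\<lambda>\<theta>. cis (of_int m * \<theta>))"
      by (intro continuous_intros)
  qed simp
  also have "\<dots> = 0"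
    using cis_multiple_2pi[of "of_int m"] by (simp add: mult_ac)
  finally show ?thesis
    using False by (simp add: integral_circle)
qed

lemma integral_circle_sums:
  fixes g :: "nat \<Rightarrow> real \<Rightarrow> complex"
  assumes [measurable]: "\<And>n. g n \<in> borel_measurable borel" and b: "\<And>n \<theta>. norm (g n \<theta>) \<le> 1"
    and c: "summable (\<lambda>n. norm (c n))"
  shows "(\<lambda>n. c n * integral\<^sup>L circle (g n)) sums integral\<^sup>L circle (\<lambda>\<theta>. \<Sum>n. c n * g n \<theta>)"
proof -
  have le: "norm (c n * g n \<theta>) \<le> norm (c n)" for n \<theta>
    using mult_left_mono[OF b, of "norm (c n)"] by (simp add: norm_mult)
  have int: "integrable circle (\<lambda>\<theta>. c n * g n \<theta>)" for n
    by (rule circle.integrable_const_bound[where B = "norm (c n)"]) (use le in auto)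
  have "(\<lambda>n. integral\<^sup>L circle (\<lambda>\<theta>. c n * g n \<theta>)) sums integral\<^sup>L circle (\<lambda>\<theta>. \<Sum>n. c n * g n \<theta>)"
  proof (rule sums_integral[OF int])
    show "AE \<theta> in circle. summable (\<lambda>n. norm (c n * g n \<theta>))"
      by (rule AE_I2, rule summable_comparison_test'[OF c]) (use le in auto)
    have "norm (integral\<^sup>L circle (\<lambda>\<theta>. norm (c n * g n \<theta>))) \<le> norm (c n) * measure circle (space circle)" for n
    proof -
      have "integral\<^sup>L circle (\<lambda>\<theta>. norm (c n * g n \<theta>)) \<le> integral\<^sup>L circle (\<lambda>\<theta>. norm (c n))"
        by (rule integral_mono) (use int le in auto)
      then show ?thesis by (simp add: mult.commute)
    qed
    then show "summable (\<lambda>n. integral\<^sup>L circle (\<lambda>\<theta>. norm (c n * g n \<theta>)))"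
      by (intro summable_comparison_test'[OF summable_mult2[OF c]]) auto
  qed
  then show ?thesis by simp
qed

lemma summable_norm_exp': "summable (\<lambda>n. norm (z ^ n / fact n :: complex))"
  using summable_norm_exp[of z] by (simp add: scaleR_conv_of_real divide_inverse mult.commute)

lemma suminf_exp: "exp z = (\<Sum>n. z ^ n / fact n :: complex)"
  by (simp add: exp_def scaleR_conv_of_real divide_inverse mult.commute)

text \<open>
  Integrating the exponential series termwise leaves only the term with exponent \<open>m\<close>.
\<close>

lemma integral_circle_exp:
  fixes A :: complex
  shows "integral\<^sup>L circle (\<lambda>\<theta>. exp (A * cis \<theta>) * cis (- (of_int m * \<theta>))) =
    (if m \<ge> 0 then 2 * pi * (A ^ nat m / fact (nat m)) else 0)"
proof -
  have "exp (A * cis \<theta>) * cis (- (of_int m * \<theta>)) =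
      (\<Sum>n. A ^ n / fact n * cis (of_int (int n - m) * \<theta>))" for \<theta>
  proof -
    have "exp (A * cis \<theta>) * cis (- (of_int m * \<theta>)) = (\<Sum>n. (A * cis \<theta>) ^ n / fact n * cis (- (of_int m * \<theta>)))"
      by (subst suminf_exp, rule suminf_mult2)
        (rule summable_norm_cancel[OF summable_norm_exp'])
    also have "\<dots> = (\<Sum>n. A ^ n / fact n * cis (of_int (int n - m) * \<theta>))"
    proof (rule suminf_cong)
      fix n
      have "cis \<theta> ^ n * cis (- (of_int m * \<theta>)) = cis (of_int (int n - m) * \<theta>)"
        by (simp only: Complex.DeMoivre cis_mult) (simp add: algebra_simps)
      then show "(A * cis \<theta>) ^ n / fact n * cis (- (of_int m * \<theta>)) = A ^ n / fact n * cis (of_int (int n - m) * \<theta>)"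
        by (simp add: power_mult_distrib)
    qed
    finally show ?thesis .
  qed
  then have "integral\<^sup>L circle (\<lambda>\<theta>. exp (A * cis \<theta>) * cis (- (of_int m * \<theta>))) =
     integral\<^sup>L circle (\<lambda>\<theta>. (\<Sum>n. A ^ n / fact n * cis (of_int (int n - m) * \<theta>)))"
    by simp
  also have "\<dots> = (\<Sum>n. A ^ n / fact n * integral\<^sup>L circle (\<lambda>\<theta>. cis (of_int (int n - m) * \<theta>)))"
    by (rule sums_unique, rule integral_circle_sums[OF _ _ summable_norm_exp']) simp_all
  also have "\<dots> = (\<Sum>n. if int n = m then A ^ n / fact n * (2 * pi) else 0)"
    by (rule suminf_cong) (unfold integral_circle_cis, simp)
  also have "\<dots> = (if m \<ge> 0 then 2 * pi * (A ^ nat m / fact (nat m)) else 0)"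
  proof (cases "m \<ge> 0")
    case True
    then have "(\<lambda>n. if int n = m then A ^ n / fact n * (2 * pi) else 0) =
      (\<lambda>n. if n = nat m then A ^ n / fact n * (2 * pi) else 0)" by (intro ext if_cong) auto
    then show ?thesis
      using sums_unique[OF sums_single[of "nat m" "\<lambda>n. A ^ n / fact n * (2 * pi)"]] True
      by (simp add: mult_ac)
  next
    case False
    then have "(\<lambda>n. if int n = m then A ^ n / fact n * (2 * pi) else 0) = (\<lambda>_. 0)"
      by auto
    then show ?thesis using False by simp
  qed
  finally show ?thesis .
qed

text \<open>
  The coefficient of \<open>x\<^sup>k\<close> in \<open>exp (A x + B / x)\<close> is the sum of these terms: \<open>n\<close> factors \<open>B / x\<close> and
  \<open>k + n\<close> factors \<open>A x\<close> multiply to a power \<open>x\<^sup>k\<close>.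
\<close>

definition bessel_term :: "int \<Rightarrow> complex \<Rightarrow> complex \<Rightarrow> nat \<Rightarrow> complex" where
  "bessel_term k A B n =
    (if k + int n \<ge> 0 then A ^ nat (k + int n) * B ^ n / (fact (nat (k + int n)) * fact n) else 0)"

text \<open>
  Only the factor \<open>exp (B cis (-\<theta>))\<close> is expanded here; what remains under the integral in the \<open>n\<close>-th
  term is a Fourier coefficient of \<open>exp (A cis \<theta>)\<close>.
\<close>

lemma integral_circle_generating_function:
  "(\<lambda>n. 2 * pi * bessel_term k A B n) sums
    integral\<^sup>L circle (\<lambda>\<theta>. exp (A * cis \<theta> + B * cis (- \<theta>)) * cis (- (of_int k * \<theta>)))"
proof -
  let ?e = "exp (cmod A)"
  \<comment> \<open>The functions \<open>?g n\<close> are scaled by \<open>?e\<close> so as to be bounded by \<open>1\<close>.\<close>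
  let ?g = "\<lambda>n \<theta>. exp (A * cis \<theta>) * cis (- (of_int (k + int n) * \<theta>)) / ?e"
  have b: "norm (exp (A * cis \<theta>)) \<le> ?e" for \<theta>
    using norm_exp[of "A * cis \<theta>"] by (simp add: norm_mult)
  have "exp (A * cis \<theta> + B * cis (- \<theta>)) * cis (- (of_int k * \<theta>)) =
      (\<Sum>n. (?e * (B ^ n / fact n)) * ?g n \<theta>)" for \<theta>
  proof -
    have "exp (A * cis \<theta> + B * cis (- \<theta>)) * cis (- (of_int k * \<theta>)) =
        (exp (A * cis \<theta>) * cis (- (of_int k * \<theta>))) * (\<Sum>n. (B * cis (- \<theta>)) ^ n / fact n)"
      by (simp add: exp_add flip: suminf_exp)
    also have "\<dots> = (\<Sum>n. (exp (A * cis \<theta>) * cis (- (of_int k * \<theta>))) * ((B * cis (- \<theta>)) ^ n / fact n))"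
      by (rule suminf_mult [symmetric], rule summable_norm_cancel[OF summable_norm_exp'])
    also have "\<dots> = (\<Sum>n. (?e * (B ^ n / fact n)) * ?g n \<theta>)"
    proof (rule suminf_cong)
      fix n
      have "cis (- (of_int (k + int n) * \<theta>)) = cis (- (of_int k * \<theta>)) * cis (- \<theta>) ^ n"
        by (simp only: Complex.DeMoivre cis_mult) (simp add: algebra_simps)
      then show "(exp (A * cis \<theta>) * cis (- (of_int k * \<theta>))) * ((B * cis (- \<theta>)) ^ n / fact n) = (?e * (B ^ n / fact n)) * ?g n \<theta>"
        by (simp add: power_mult_distrib)
    qed
    finally show ?thesis .
  qed
  then have "integral\<^sup>L circle (\<lambda>\<theta>. exp (A * cis \<theta> + B * cis (- \<theta>)) * cis (- (of_int k * \<theta>))) =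
     integral\<^sup>L circle (\<lambda>\<theta>. (\<Sum>n. (?e * (B ^ n / fact n)) * ?g n \<theta>))"
    by simp
  also have "(\<lambda>n. (?e * (B ^ n / fact n)) * integral\<^sup>L circle (?g n)) sums \<dots>"
  proof (rule integral_circle_sums)
    show "norm (?g n \<theta>) \<le> 1" for n \<theta>
      using b[of \<theta>] by (simp add: norm_mult norm_divide)
    show "summable (\<lambda>n. norm (?e * (B ^ n / fact n)))"
      using summable_mult[OF summable_norm_exp'[of B], of ?e] by (simp add: norm_mult norm_divide)
  qed measurable
  finally have s: "(\<lambda>n. (?e * (B ^ n / fact n)) * integral\<^sup>L circle (?g n)) sums
     integral\<^sup>L circle (\<lambda>\<theta>. exp (A * cis \<theta> + B * cis (- \<theta>)) * cis (- (of_int k * \<theta>)))" .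
  have "(?e * (B ^ n / fact n)) * integral\<^sup>L circle (?g n) = 2 * pi * bessel_term k A B n" for n
    using integral_circle_exp[of A "k + int n"] by (simp add: bessel_term_def)
  with s show ?thesis by simp
qed

text \<open>
  The generating function of the modified Bessel functions, with its two parameters kept independent:
  \<open>w\<close> is a square root of \<open>A B\<close> and \<open>s\<close> is the square root \<open>w / B\<close> of \<open>A / B\<close> (for \<open>B \<noteq> 0\<close>), so that
  \<open>A\<^sup>k\<^sup>+\<^sup>n B\<^sup>n = s\<^sup>k w\<^sup>2\<^sup>n\<^sup>+\<^sup>k\<close>. This is where a consistent choice of the roots enters.
\<close>

lemma integral_circle_bessel_I:
  fixes A B s w :: complex
  assumes "s \<noteq> 0" "A = s * w" "B * s = w"
  shows "integral\<^sup>L circle (\<lambda>\<theta>. exp (A * cis \<theta> + B * cis (- \<theta>)) * cis (- (of_int k * \<theta>))) =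
    2 * pi * (s powi k * bessel_I k (2 * w))"
proof -
  let ?d = "\<lambda>n. rGamma (of_int (k + int n + 1)) / fact n * w powi (2 * int n + k)"
  have B: "B = w / s" using assms by auto
  have eq: "bessel_term k A B n = s powi k * ?d n" for n
  proof (cases "k + int n \<ge> 0")
    case True
    define m where "m = nat (k + int n)"
    have k: "k = int m - int n" using True by (simp add: m_def)
    have "rGamma (of_int (k + int n + 1)) = (1 / fact m :: complex)"
      using Gamma_fact[of m, where 'a = complex] by (simp add: k add.commute rGamma_inverse_Gamma divide_inverse)
    moreover have "w powi (2 * int n + k) = w ^ (n + m)"
      by (simp add: k flip: power_int_of_nat)
    moreover have "s powi k = s ^ m / s ^ n"
      using assms(1) by (simp add: k power_int_diff)
    ultimately show ?thesis
      using True by (simp add: bessel_term_def m_def[symmetric] assms(2) B power_mult_distrib power_divide power_add)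
  next
    case False
    then have "(of_int (k + int n + 1) :: complex) \<in> \<int>\<^sub>\<le>\<^sub>0"
      by (intro nonpos_Ints_of_int) simp
    then have "rGamma (of_int (k + int n + 1)) = (0::complex)"
      by (simp only: rGamma_eq_zero_iff)
    then show ?thesis using False by (simp add: bessel_term_def)
  qed
  have sums: "(\<lambda>n. 2 * pi * (s powi k * ?d n)) sums
      integral\<^sup>L circle (\<lambda>\<theta>. exp (A * cis \<theta> + B * cis (- \<theta>)) * cis (- (of_int k * \<theta>)))"
    using integral_circle_generating_function[of k A B] by (simp only: eq)
  \<comment> \<open>The convergence of the Bessel series comes for free with the sum of the generating function.\<close>
  then have "summable (\<lambda>n. (2 * pi * s powi k) * ?d n)"
    by (simp add: sums_iff mult.assoc)
  then have "summable ?d"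
    by (rule summable_mult_D) (use assms(1) in \<open>simp add: power_int_eq_0_iff\<close>)
  then have "(\<lambda>n. (2 * pi * s powi k) * ?d n) sums ((2 * pi * s powi k) * bessel_I k (2 * w))"
    unfolding bessel_I_def by (intro sums_mult) (simp add: summable_sums)
  with sums show ?thesis
    by (auto simp: mult.assoc dest: sums_unique2)
qed

section \<open>Integrability of the kernel\<close>

lemma integrable_gaussian_complex:
  assumes c: "c > 0"
  shows "integrable lborel (\<lambda>z::complex. exp (- c * (cmod z)\<^sup>2))"
proof (rule integrableI_bounded)
  have "(\<integral>\<^sup>+z. ennreal (norm (exp (- c * (cmod z)\<^sup>2))) \<partial>lborel) =
      (\<integral>\<^sup>+r. ennreal (2 * pi * r) * ennreal (exp (- c * r\<^sup>2)) \<partial>lborel)"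
    by (simp add: nn_integral_radial[of "\<lambda>r. ennreal (exp (- c * r\<^sup>2))", simplified])
  also have "\<dots> = (\<integral>\<^sup>+r. ennreal (2 * pi * r * exp (- c * r\<^sup>2)) * indicator {0..} r \<partial>lborel)"
    by (intro nn_integral_cong) (auto simp: indicator_def ennreal_neg mult_nonneg_nonpos ennreal_mult)
  also have "\<dots> = ennreal (0 - (- (pi / c) * exp (- c * 0\<^sup>2)))"
  proof (rule nn_integral_FTC_atLeast)
    show "((\<lambda>r. - (pi / c) * exp (- c * r\<^sup>2)) has_real_derivative 2 * pi * r * exp (- c * r\<^sup>2)) (at r)" for r
      using c by (auto intro!: derivative_eq_intros simp: field_simps)
    have "filterlim (\<lambda>r. - c * r\<^sup>2) at_bot at_top"
      using c by (intro filterlim_tendsto_neg_mult_at_bot[of _ "-c"] filterlim_pow_at_top filterlim_ident) auto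
    then have "((\<lambda>r. exp (- c * r\<^sup>2)) \<longlongrightarrow> 0) at_top"
      by (rule filterlim_compose[OF exp_at_bot])
    from tendsto_mult_right_zero[OF this, of "- (pi / c)"]
    show "((\<lambda>r. - (pi / c) * exp (- c * r\<^sup>2)) \<longlongrightarrow> 0) at_top" by simp
  qed (use c in auto)
  finally show "(\<integral>\<^sup>+z. ennreal (norm (exp (- c * (cmod z)\<^sup>2))) \<partial>lborel) < \<infinity>" by simp
qed simp

lemma Re_cayley_pos:
  fixes w :: complex
  assumes "cmod w < 1"
  shows "Re ((1 + w) / (1 - w)) > 0"
proof -
  have "(Re w)\<^sup>2 + (Im w)\<^sup>2 < 1"
    using assms by (simp add: cmod_def)
  moreover have "1 - w \<noteq> 0" using assms by auto
  then have "(1 - Re w)\<^sup>2 + (Im w)\<^sup>2 > 0"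
    by (simp add: sum_power2_gt_zero_iff complex_eq_iff)
  moreover have "Re ((1 + w) / (1 - w)) = (1 - ((Re w)\<^sup>2 + (Im w)\<^sup>2)) / ((1 - Re w)\<^sup>2 + (Im w)\<^sup>2)"
    by (simp add: Re_divide power2_eq_square algebra_simps)
  ultimately show ?thesis by simp
qed

lemma Re_mult_of_real: "Re (z * of_real x) = Re z * x"
  by simp

text \<open>
  The weighted kernel has modulus of order \<open>exp (- (c + \<nu> / 2) |\<zeta>|\<^sup>2 + O(|\<zeta>|))\<close>, where
  \<open>c = \<nu> / 2 * Re ((1 + u v) / (1 - u v))\<close> is positive because the Cayley transform maps the disc to the
  right half-plane. Half of \<open>c |\<zeta>|\<^sup>2\<close> absorbs the linear term. The factor \<open>exp (- (\<nu> / 2) |\<zeta>|\<^sup>2)\<close> is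
  kept apart, as it is the one that makes \<open>f\<close> square integrable.
\<close>

lemma frft_kernel_gaussian_bound:
  fixes u v :: complex
  assumes "\<nu> > 0" "cmod (u * v) < 1"
  obtains c C where "c > 0"
    "\<And>\<zeta> \<xi>. cmod \<xi> = \<rho> \<Longrightarrow> cmod (frft_kernel \<nu> u v \<zeta> \<xi> * of_real (exp (- \<nu> * (cmod \<zeta>)\<^sup>2))) \<le>
      C * (exp (- (\<nu> / 2) * (cmod \<zeta>)\<^sup>2) * exp (- (c / 2) * (cmod \<zeta>)\<^sup>2))"
proof
  define w where "w = u * v"
  define a where "a = of_real \<nu> / (1 - w)"
  define c where "c = \<nu> / 2 * Re ((1 + w) / (1 - w))"
  define b where "b = cmod a * ((cmod u + cmod v) * \<rho>)"
  define C where "C = cmod (a / pi) * exp (b\<^sup>2 / (2 * c) - Re (a * w) * \<rho>\<^sup>2)"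
  show c: "c > 0"
    unfolding c_def using assms Re_cayley_pos by (simp add: w_def)
  have w1: "1 - w \<noteq> 0" using assms by (auto simp: w_def)
  have "a * w + of_real (\<nu> / 2) = of_real (\<nu> / 2) * ((1 + w) / (1 - w))"
    using w1 by (simp add: a_def field_simps)
  then have "Re (a * w + of_real (\<nu> / 2)) = Re (of_real (\<nu> / 2) * ((1 + w) / (1 - w)))"
    by simp
  also have "\<dots> = c"
    unfolding c_def by (subst mult.commute, subst Re_mult_of_real) (rule mult.commute)
  finally have aw: "Re (a * w) = c - \<nu> / 2" by simp
  show "cmod (frft_kernel \<nu> u v \<zeta> \<xi> * of_real (exp (- \<nu> * (cmod \<zeta>)\<^sup>2))) \<le>
      C * (exp (- (\<nu> / 2) * (cmod \<zeta>)\<^sup>2) * exp (- (c / 2) * (cmod \<zeta>)\<^sup>2))" if \<xi>: "cmod \<xi> = \<rho>" for \<zeta> \<xi>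
  proof -
    let ?z = "cmod \<zeta>"
    let ?L = "a * (u * cnj \<zeta> * \<xi> + v * \<zeta> * cnj \<xi>)"
    have "cmod ?L \<le> b * ?z"
    proof -
      have "cmod (u * cnj \<zeta> * \<xi> + v * \<zeta> * cnj \<xi>) \<le> (cmod u + cmod v) * \<rho> * ?z"
        by (rule order_trans[OF norm_triangle_ineq]) (simp add: norm_mult \<xi> algebra_simps)
      from mult_left_mono[OF this, of "cmod a"] show ?thesis
        by (simp add: b_def norm_mult mult_ac)
    qed
    then have L: "Re ?L \<le> b * ?z"
      using complex_Re_le_cmod[of ?L] by linarith
    have sq: "b * ?z \<le> c / 2 * ?z\<^sup>2 + b\<^sup>2 / (2 * c)"
    proof -
      have "0 \<le> (c * ?z - b)\<^sup>2 / (2 * c)" using c by simp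
      also have "\<dots> = c / 2 * ?z\<^sup>2 + b\<^sup>2 / (2 * c) - b * ?z"
        using c by (simp add: field_simps power2_eq_square)
      finally show ?thesis by simp
    qed
    have "frft_kernel \<nu> u v \<zeta> \<xi> * of_real (exp (- \<nu> * ?z\<^sup>2)) =
        a / pi * exp (?L - a * w * of_real (?z\<^sup>2 + \<rho>\<^sup>2) - of_real (\<nu> * ?z\<^sup>2))"
      using w1 by (simp add: frft_kernel_def a_def w_def \<xi> exp_of_real[symmetric] exp_add[symmetric] exp_diff[symmetric] mult_exp_exp algebra_simps)
    then have "cmod (frft_kernel \<nu> u v \<zeta> \<xi> * of_real (exp (- \<nu> * ?z\<^sup>2))) =
        cmod (a / pi) * exp (Re ?L - Re (a * w) * (?z\<^sup>2 + \<rho>\<^sup>2) - \<nu> * ?z\<^sup>2)"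
      by (simp only: norm_mult norm_exp_eq_Re minus_complex.sel Re_mult_of_real Re_complex_of_real)
    also have "\<dots> \<le> cmod (a / pi) * exp ((b\<^sup>2 / (2 * c) - Re (a * w) * \<rho>\<^sup>2) + - (\<nu> / 2) * ?z\<^sup>2 + - (c / 2) * ?z\<^sup>2)"
    proof -
      have "x - A * (?z\<^sup>2 + \<rho>\<^sup>2) - \<nu> * ?z\<^sup>2 \<le> (b\<^sup>2 / (2 * c) - A * \<rho>\<^sup>2) + - (\<nu> / 2) * ?z\<^sup>2 + - (c / 2) * ?z\<^sup>2"
        if "x \<le> b * ?z" "A = c - \<nu> / 2" for x A
        using that(1) sq unfolding that(2) by (simp add: algebra_simps)
      from this[OF L aw] show ?thesis
        by (intro mult_left_mono) (simp_all only: exp_le_cancel_iff norm_ge_zero)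
    qed
    also have "\<dots> = C * (exp (- (\<nu> / 2) * ?z\<^sup>2) * exp (- (c / 2) * ?z\<^sup>2))"
      by (simp only: C_def exp_add mult.assoc)
    finally show ?thesis .
  qed
qed

lemma borel_measurable_frft_kernel [measurable (raw)]:
  assumes [measurable]: "f \<in> borel_measurable M" "g \<in> borel_measurable M"
  shows "(\<lambda>x. frft_kernel \<nu> u v (f x) (g x)) \<in> borel_measurable M"
proof -
  have [measurable]: "cnj \<in> borel_measurable borel"
    by (intro borel_measurable_continuous_onI continuous_intros)
  show ?thesis
    unfolding frft_kernel_def by measurable
qed

section \<open>Angular coefficients of the transform of a Borel function\<close>

lemma angular_coeff_lborel:
  assumes [measurable]: "f \<in> borel_measurable borel"
  shows "angular_coeff f k r = 1 / (2 * pi) * (LINT \<theta>|circle. f (rcis r \<theta>) * cis (- (of_int k * \<theta>)))"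
  unfolding angular_coeff_def integral_circle set_lebesgue_integral_def
  by (subst integral_completion) simp_all

text \<open>
  For a Borel function \<open>f\<close> the two sides agree by Fubini's theorem and polar coordinates. The second
  claim, measurability of the integrand of the Hankel transform, is what allows one to replace \<open>f\<close>
  by another representative. It follows from the fact that the factor \<open>Q\<close>, which contains the
  Bessel function, is the integral of a measurable function of two variables.
\<close>

lemma
  fixes \<nu> \<rho> :: real and u v s t :: complex and f :: "complex \<Rightarrow> complex"
  assumes \<nu>: "\<nu> > 0" and u: "cmod u < 1" "u \<noteq> 0" and v: "cmod v < 1" "v \<noteq> 0"
    and st: "consistent_roots u v s t"
    and [measurable]: "f \<in> borel_measurable borel"
    and f: "integrable lborel (\<lambda>z. (cmod (f z))\<^sup>2 * exp (- \<nu> * (cmod z)\<^sup>2))"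
    and \<rho>: "\<rho> \<ge> 0"
  shows angular_coeff_frft_borel:
      "angular_coeff (frft \<nu> u v f) k \<rho> = frac_hankel \<nu> k u v s t (angular_coeff f k) \<rho>"
    and borel_measurable_frac_hankel_integrand:
      "(\<lambda>r. indicator {0..} r *\<^sub>R (of_real r * angular_coeff f k r *
        bessel_I k (2 * of_real \<nu> * t / (1 - u * v) * of_real r * of_real \<rho>) *
        exp (- of_real \<nu> * (of_real (r\<^sup>2) + u * v * of_real (\<rho>\<^sup>2)) / (1 - u * v)))) \<in> borel_measurable borel"
proof -
  define w where "w = u * v"
  define a where "a = of_real \<nu> / (1 - w)"
  have uv1: "cmod (u * v) < 1"
    using mult_strict_mono'[of "cmod u" 1 "cmod v" 1] u v by (simp add: norm_mult)
  then have w1: "1 - w \<noteq> 0" by (auto simp: w_def)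
  have a_eq: "a * w + of_real \<nu> = a"
    using w1 by (simp add: a_def field_simps)
  have nz: "s \<noteq> 0" "t \<noteq> 0" and st_u: "s * t = u"
    using st u v by (auto simp: consistent_roots_def)
  have "t * t = t * (s * v)"
    using st by (simp add: consistent_roots_def power2_eq_square mult_ac)
  then have sv: "v * s = t" using nz by simp

  define K where "K \<zeta> \<phi> = frft_kernel \<nu> u v \<zeta> (rcis \<rho> \<phi>) * of_real (exp (- \<nu> * (cmod \<zeta>)\<^sup>2))" for \<zeta> \<phi>
  define E where "E \<phi> = cis (- (of_int k * \<phi>))" for \<phi>
  have [measurable]: "E \<in> borel_measurable borel"
    unfolding E_def by measurable
  have K_meas [measurable]: "(\<lambda>x. K (p x) (q x)) \<in> borel_measurable M"
    if [measurable]: "p \<in> borel_measurable M" "q \<in> borel_measurable M" for p q and M :: "'z measure"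
    unfolding K_def by measurable
  \<comment> \<open>\<open>Q r\<close> is the closed form of the integral of \<open>K (rcis r 0) \<phi> * E \<phi>\<close> over \<open>\<phi>\<close>.\<close>
  define Q where "Q r = 2 * a * exp (- a * (of_real (r\<^sup>2) + w * of_real (\<rho>\<^sup>2))) *
      (s powi k * bessel_I k (2 * (a * t * of_real r * of_real \<rho>)))" for r :: real

  have K_polar: "K (rcis r \<theta>) \<phi> = a / pi * exp (- a * (of_real (r\<^sup>2) + w * of_real (\<rho>\<^sup>2))) *
      exp ((a * u * of_real r * of_real \<rho> * cis (- \<theta>)) * cis \<phi> + (a * v * of_real r * of_real \<rho> * cis \<theta>) * cis (- \<phi>))"
    for r \<theta> \<phi>
  proof -
    have 1: "u * cnj (rcis r \<theta>) * rcis \<rho> \<phi> + v * rcis r \<theta> * cnj (rcis \<rho> \<phi>) =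
        (u * of_real r * of_real \<rho> * cis (- \<theta>)) * cis \<phi> + (v * of_real r * of_real \<rho> * cis \<theta>) * cis (- \<phi>)"
      by (simp add: rcis_def cis_cnj mult_ac)
    \<comment> \<open>The weight and the Gaussian factor of the kernel combine because \<open>a w + \<nu> = a\<close>.\<close>
    have 2: "a * (- w * of_real (r\<^sup>2 + \<rho>\<^sup>2)) + - of_real \<nu> * of_real (r\<^sup>2) = - (a * w + of_real \<nu>) * of_real (r\<^sup>2) - a * w * of_real (\<rho>\<^sup>2)"
      by (simp add: algebra_simps)
    have 3: "of_real \<nu> / (of_real pi * (1 - w)) = a / pi"
      by (simp add: a_def)
    have 4: "of_real \<nu> / (1 - w) = a" by (simp add: a_def)
    have 5: "of_real (exp (- \<nu> * r\<^sup>2)) = exp (- of_real \<nu> * of_real (r\<^sup>2) :: complex)"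
      by (simp flip: exp_of_real)
    have 6: "(cmod (rcis r \<theta>))\<^sup>2 = r\<^sup>2" "(cmod (rcis \<rho> \<phi>))\<^sup>2 = \<rho>\<^sup>2"
      by simp_all
    have "K (rcis r \<theta>) \<phi> = a / pi * exp (a * (- w * of_real (r\<^sup>2 + \<rho>\<^sup>2) + (u * cnj (rcis r \<theta>) * rcis \<rho> \<phi> + v * rcis r \<theta> * cnj (rcis \<rho> \<phi>))) + - of_real \<nu> * of_real (r\<^sup>2))"
      unfolding K_def frft_kernel_def w_def[symmetric] 3 4 5 6
      by (simp only: exp_add mult.assoc add.assoc)
    also have "a * (- w * of_real (r\<^sup>2 + \<rho>\<^sup>2) + (u * cnj (rcis r \<theta>) * rcis \<rho> \<phi> + v * rcis r \<theta> * cnj (rcis \<rho> \<phi>))) + - of_real \<nu> * of_real (r\<^sup>2) =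
        - a * (of_real (r\<^sup>2) + w * of_real (\<rho>\<^sup>2)) +
        ((a * u * of_real r * of_real \<rho> * cis (- \<theta>)) * cis \<phi> + (a * v * of_real r * of_real \<rho> * cis \<theta>) * cis (- \<phi>))"
      using 2 unfolding 1 a_eq by (simp add: algebra_simps)
    finally show ?thesis by (simp only: exp_add mult.assoc)
  qed
  have K_coeff: "(LINT \<phi>|circle. K (rcis r \<theta>) \<phi> * E \<phi>) = E \<theta> * Q r" for r \<theta>
  proof -
    let ?W = "a * t * of_real r * of_real \<rho>"
    have "cis (- \<theta>) powi k = E \<theta>"
      by (simp add: E_def cis_power_int)
    moreover have "(LINT \<phi>|circle. exp ((a * u * of_real r * of_real \<rho> * cis (- \<theta>)) * cis \<phi> + (a * v * of_real r * of_real \<rho> * cis \<theta>) * cis (- \<phi>)) * E \<phi>) =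
        2 * pi * ((s * cis (- \<theta>)) powi k * bessel_I k (2 * ?W))"
      unfolding E_def
    proof (rule integral_circle_bessel_I)
      show "a * v * of_real r * of_real \<rho> * cis \<theta> * (s * cis (- \<theta>)) = ?W"
        by (simp add: cis_mult flip: sv)
    qed (use nz in \<open>simp_all flip: st_u\<close>)
    ultimately show ?thesis
      by (simp add: K_polar mult.assoc power_int_mult_distrib Q_def)
  qed
  have Q_meas [measurable]: "Q \<in> borel_measurable borel"
  proof -
    have E_0: "E 0 = 1" by (simp add: E_def)
    have "Q = (\<lambda>r. LINT \<phi>|circle. K (rcis r 0) \<phi> * E \<phi>)"
      by (rule ext) (simp only: K_coeff E_0 mult_1)
    then show ?thesis by simp
  qed

  obtain c C where c: "c > 0" and bound: "\<And>\<zeta> \<phi>. cmod (K \<zeta> \<phi>) \<le>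
      C * (exp (- (\<nu> / 2) * (cmod \<zeta>)\<^sup>2) * exp (- (c / 2) * (cmod \<zeta>)\<^sup>2))"
    using frft_kernel_gaussian_bound[OF \<nu> uv1, of \<rho>] \<rho> unfolding K_def by (metis abs_of_nonneg complex_mod_rcis)
  \<comment> \<open>By \<open>2 x y \<le> x\<^sup>2 + y\<^sup>2\<close>, this \<open>D\<close> dominates the integrand \<open>f \<zeta> * K \<zeta> \<phi> * E \<phi>\<close>.\<close>
  define D where "D \<zeta> = C / 2 * ((cmod (f \<zeta>))\<^sup>2 * exp (- \<nu> * (cmod \<zeta>)\<^sup>2) + exp (- c * (cmod \<zeta>)\<^sup>2))" for \<zeta>
  have D_int: "integrable lborel D"
    unfolding D_def using f integrable_gaussian_complex[OF c] by simp
  have C: "C \<ge> 0"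
    using order_trans[OF norm_ge_zero bound[of 0 0]] by simp
  have D_bound: "cmod (f \<zeta> * K \<zeta> \<phi> * E \<phi>) \<le> D \<zeta>" for \<zeta> \<phi>
  proof -
    let ?x = "cmod (f \<zeta>) * exp (- (\<nu> / 2) * (cmod \<zeta>)\<^sup>2)" and ?y = "exp (- (c / 2) * (cmod \<zeta>)\<^sup>2)"
    have "cmod (f \<zeta> * K \<zeta> \<phi> * E \<phi>) \<le> C * (?x * ?y)"
      using mult_left_mono[OF bound[of \<zeta> \<phi>], of "cmod (f \<zeta>)"] by (simp add: norm_mult E_def mult_ac)
    also have "\<dots> \<le> C * ((?x\<^sup>2 + ?y\<^sup>2) / 2)"
      using sum_squares_bound[of ?x ?y] C by (intro mult_left_mono) auto
    also have "\<dots> = D \<zeta>"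
      by (simp add: D_def power_mult_distrib exp_double[symmetric])
    finally show ?thesis .
  qed
  \<comment> \<open>The dominating function \<open>D\<close> does not depend on \<open>\<phi>\<close>, so it is also integrable on the product.\<close>
  have D_int2: "integrable (lborel \<Otimes>\<^sub>M circle) (\<lambda>p. D (fst p))"
  proof (rule lborel_circle.Fubini_integrable)
    show "(\<lambda>p. D (fst p)) \<in> borel_measurable (lborel \<Otimes>\<^sub>M circle)"
      using D_int by measurable
  qed (use D_int in simp_all)
  have int: "integrable (lborel \<Otimes>\<^sub>M circle) (\<lambda>(\<zeta>, \<phi>). f \<zeta> * K \<zeta> \<phi> * E \<phi>)"
  proof (rule Bochner_Integration.integrable_bound[OF D_int2])
    show "AE p in lborel \<Otimes>\<^sub>M circle. norm (case p of (\<zeta>, \<phi>) \<Rightarrow> f \<zeta> * K \<zeta> \<phi> * E \<phi>) \<le> norm (D (fst p))"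
      using D_bound by (intro AE_I2) (auto intro: order_trans[OF _ abs_ge_self])
  qed (simp add: case_prod_beta')

  have frft: "frft \<nu> u v f (rcis \<rho> \<phi>) = (LINT \<zeta>|lborel. f \<zeta> * K \<zeta> \<phi>)" for \<phi>
    unfolding frft_def K_def by (subst integral_completion) (simp_all add: mult.assoc)
  have frft_meas: "frft \<nu> u v f \<in> borel_measurable borel"
  proof -
    have "frft \<nu> u v f = (\<lambda>\<xi>. LINT \<zeta>|lborel. f \<zeta> * frft_kernel \<nu> u v \<zeta> \<xi> * of_real (exp (- \<nu> * (cmod \<zeta>)\<^sup>2)))"
      unfolding frft_def by (intro ext integral_completion) measurable
    then show ?thesis by simp
  qed
  have "2 * pi * angular_coeff (frft \<nu> u v f) k \<rho> = (LINT \<phi>|circle. LINT \<zeta>|lborel. f \<zeta> * K \<zeta> \<phi> * E \<phi>)"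
    unfolding angular_coeff_lborel[OF frft_meas] frft by (simp add: E_def)
  also have "\<dots> = (LINT \<zeta>|lborel. LINT \<phi>|circle. f \<zeta> * K \<zeta> \<phi> * E \<phi>)"
    by (rule lborel_circle.Fubini_integral[OF int])
  also have "\<dots> = (LINT r:{0..}|lborel. r *\<^sub>R (LINT \<theta>|circle. LINT \<phi>|circle. f (rcis r \<theta>) * K (rcis r \<theta>) \<phi> * E \<phi>))"
    by (rule integral_polar, rule lborel_circle.integrable_fst[OF int])
  also have "\<dots> = (LINT r:{0..}|lborel. r *\<^sub>R (2 * pi * angular_coeff f k r * Q r))"
  proof -
    have "(LINT \<theta>|circle. LINT \<phi>|circle. f (rcis r \<theta>) * K (rcis r \<theta>) \<phi> * E \<phi>) = 2 * pi * angular_coeff f k r * Q r" for r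
    proof -
      have "(LINT \<theta>|circle. LINT \<phi>|circle. f (rcis r \<theta>) * K (rcis r \<theta>) \<phi> * E \<phi>) =
          (LINT \<theta>|circle. f (rcis r \<theta>) * (LINT \<phi>|circle. K (rcis r \<theta>) \<phi> * E \<phi>))"
        by (simp add: mult.assoc)
      also have "\<dots> = (LINT \<theta>|circle. f (rcis r \<theta>) * E \<theta>) * Q r"
        by (simp add: K_coeff flip: mult.assoc)
      finally show ?thesis
        by (simp add: angular_coeff_lborel E_def)
    qed
    then show ?thesis by simp
  qed
  finally have main: "2 * pi * angular_coeff (frft \<nu> u v f) k \<rho> = (LINT r:{0..}|lborel. r *\<^sub>R (2 * pi * angular_coeff f k r * Q r))" .

  let ?J = "\<lambda>r. indicator {0..} r *\<^sub>R (of_real r * angular_coeff f k r *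
        bessel_I k (2 * of_real \<nu> * t / (1 - u * v) * of_real r * of_real \<rho>) *
        exp (- of_real \<nu> * (of_real (r\<^sup>2) + u * v * of_real (\<rho>\<^sup>2)) / (1 - u * v)))"
  have J: "indicator {0..} r *\<^sub>R (r *\<^sub>R (angular_coeff f k r * Q r)) = (2 * a * s powi k) * ?J r" for r
  proof -
    have "2 * of_real \<nu> * t / (1 - u * v) * of_real r * of_real \<rho> = 2 * (a * t * of_real r * of_real \<rho>)"
      "- of_real \<nu> * (of_real (r\<^sup>2) + u * v * of_real (\<rho>\<^sup>2)) / (1 - u * v) = - a * (of_real (r\<^sup>2) + w * of_real (\<rho>\<^sup>2))"
      by (simp_all add: a_def w_def)
    then show ?thesis
      by (simp only: Q_def scaleR_conv_of_real) (simp add: mult_ac)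
  qed
  have ac_meas [measurable]: "angular_coeff f k \<in> borel_measurable borel"
    unfolding angular_coeff_lborel[OF assms(7), abs_def] by measurable
  have factor_nz: "2 * a * s powi k \<noteq> 0"
    using \<nu> w1 nz by (simp add: a_def power_int_eq_0_iff)
  have "?J = (\<lambda>r. (indicator {0..} r *\<^sub>R (r *\<^sub>R (angular_coeff f k r * Q r))) / (2 * a * s powi k))"
    by (rule ext) (simp only: J nonzero_mult_div_cancel_left [OF factor_nz])
  also have "\<dots> \<in> borel_measurable borel" by measurable
  finally show J_meas: "?J \<in> borel_measurable borel" .

  have "2 * pi * angular_coeff (frft \<nu> u v f) k \<rho> = 2 * pi * (LINT r|lborel. indicator {0..} r *\<^sub>R (r *\<^sub>R (angular_coeff f k r * Q r)))"
    unfolding main set_lebesgue_integral_def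
    by (subst integral_mult_right_zero [symmetric]) (simp add: scaleR_conv_of_real mult_ac)
  then have "2 * pi * angular_coeff (frft \<nu> u v f) k \<rho> = 2 * pi * ((2 * a * s powi k) * (LINT r|lborel. ?J r))"
    by (simp only: J integral_mult_right_zero)
  then have "angular_coeff (frft \<nu> u v f) k \<rho> = (2 * a * s powi k) * (LINT r|lborel. ?J r)"
    by (subst (asm) mult_cancel_left) simp
  also have "\<dots> = frac_hankel \<nu> k u v s t (angular_coeff f k) \<rho>"
    unfolding frac_hankel_def set_lebesgue_integral_def
    by (subst integral_completion) (use J_meas in \<open>simp_all add: a_def w_def\<close>)
  finally show "angular_coeff (frft \<nu> u v f) k \<rho> = frac_hankel \<nu> k u v s t (angular_coeff f k) \<rho>" .
qed

section \<open>From Borel functions to Lebesgue measurable functions\<close>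

text \<open>
  Lebesgue measure is complete, so a function that agrees almost everywhere with a Borel function is
  automatically measurable. It therefore suffices to know the function \<open>F\<close> almost everywhere.
\<close>

lemma integral_lebesgue_cong_AE:
  fixes F g :: "'a::euclidean_space \<Rightarrow> 'b::{banach, second_countable_topology}"
  assumes [measurable]: "g \<in> borel_measurable borel" and ae: "AE x in lborel. F x = g x"
  shows "integral\<^sup>L lebesgue F = integral\<^sup>L lborel g"
proof -
  have F: "F \<in> borel_measurable lebesgue"
  proof (rule measurableI)
    fix A :: "'b set" assume "A \<in> sets borel"
    then have A: "g -` A \<in> sets lebesgue"
      using measurable_sets[OF assms(1)] by simp
    have "AE x in lebesgue. x \<in> g -` A \<longleftrightarrow> x \<in> F -` A"
      by (rule AE_completion, rule eventually_mono[OF ae]) simp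
    from completion.in_sets_AE[OF this A] show "F -` A \<inter> space lebesgue \<in> sets lebesgue"
      by simp
  qed simp
  have "integral\<^sup>L lebesgue F = integral\<^sup>L lebesgue g"
    by (rule integral_cong_AE) (auto intro: F measurable_completion AE_completion ae)
  also have "\<dots> = integral\<^sup>L lborel g"
    by (rule integral_completion) simp
  finally show ?thesis .
qed

lemma lebesgue_ex_borel_complex:
  fixes f :: "'a::euclidean_space \<Rightarrow> complex"
  assumes [measurable]: "f \<in> borel_measurable lebesgue"
  obtains f' where "f' \<in> borel_measurable borel" "AE x in lborel. f x = f' x"
proof -
  obtain p q where p: "p \<in> borel_measurable lborel" "AE x in lborel. Re (f x) = p x"
    and q: "q \<in> borel_measurable lborel" "AE x in lborel. Im (f x) = q x"
    using completion_ex_borel_measurable_real[of "\<lambda>x. Re (f x)" lborel]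
      completion_ex_borel_measurable_real[of "\<lambda>x. Im (f x)" lborel] by auto
  show thesis
  proof
    show "(\<lambda>x. Complex (p x) (q x)) \<in> borel_measurable borel"
      using p q by simp
    show "AE x in lborel. f x = Complex (p x) (q x)"
      using p(2) q(2) by eventually_elim (simp add: complex_eq_iff)
  qed
qed

text \<open>
  By polar coordinates, a null set of the plane meets almost every circle around the origin in a null
  set of angles. At \<open>r = 0\<close> nothing can be said, as a single point is a null set.
\<close>

lemma angular_coeff_AE_eq:
  assumes [measurable]: "f' \<in> borel_measurable borel" and ae: "AE z in lborel. f z = f' z"
  shows "AE r in lborel. r > 0 \<longrightarrow> angular_coeff f k r = angular_coeff f' k r"
proof -
  have "angular_coeff f k r = angular_coeff f' k r" if "AE \<theta> in circle. f (rcis r \<theta>) = f' (rcis r \<theta>)" for r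
  proof -
    have "AE \<theta> in lborel. indicator {0..2*pi} \<theta> *\<^sub>R (f (rcis r \<theta>) * cis (- (of_int k * \<theta>))) =
        indicator {0..2*pi} \<theta> *\<^sub>R (f' (rcis r \<theta>) * cis (- (of_int k * \<theta>)))"
      using that unfolding circle_def
      by (subst (asm) AE_restrict_space_iff) (auto simp: indicator_def elim!: eventually_mono)
    from integral_lebesgue_cong_AE[OF _ this] show ?thesis
      by (simp add: angular_coeff_def set_lebesgue_integral_def integral_completion)
  qed
  with AE_polar[OF ae] show ?thesis
    by (auto elim!: eventually_mono)
qed

theorem theorem1p3:
  fixes \<nu> :: real and u v s t :: complex and f :: "complex \<Rightarrow> complex"
  assumes "\<nu> > 0"
    and "u \<in> ball 0 1 - {0}" and "v \<in> ball 0 1 - {0}"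
    and "consistent_roots u v s t"
    and "f \<in> L2_gauss \<nu>"
  shows "\<forall>k::int. \<forall>\<rho>\<ge>0.
    angular_coeff (frft \<nu> u v f) k \<rho> = frac_hankel \<nu> k u v s t (angular_coeff f k) \<rho>"
proof (intro allI impI)
  fix k :: int and \<rho> :: real assume \<rho>: "\<rho> \<ge> 0"
  have fm: "f \<in> borel_measurable lebesgue"
    and fi: "integrable lebesgue (\<lambda>z. (cmod (f z))\<^sup>2 * exp (- \<nu> * (cmod z)\<^sup>2))"
    using assms(5) by (auto simp: L2_gauss_def)
  obtain f' where [measurable]: "f' \<in> borel_measurable borel" and ae: "AE z in lborel. f z = f' z"
    using lebesgue_ex_borel_complex[OF fm] .
  have "integrable lebesgue (\<lambda>z. (cmod (f' z))\<^sup>2 * exp (- \<nu> * (cmod z)\<^sup>2))"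
    by (rule integrable_cong_AE_imp[OF fi])
      (auto intro!: measurable_completion AE_completion eventually_mono[OF ae])
  then have f'i: "integrable lborel (\<lambda>z. (cmod (f' z))\<^sup>2 * exp (- \<nu> * (cmod z)\<^sup>2))"
    by (simp add: integrable_completion)
  have "frft \<nu> u v f \<xi> = frft \<nu> u v f' \<xi>" for \<xi>
  proof -
    have "integral\<^sup>L lebesgue (\<lambda>\<zeta>. f \<zeta> * frft_kernel \<nu> u v \<zeta> \<xi> * of_real (exp (- \<nu> * (cmod \<zeta>)\<^sup>2))) =
        integral\<^sup>L lborel (\<lambda>\<zeta>. f' \<zeta> * frft_kernel \<nu> u v \<zeta> \<xi> * of_real (exp (- \<nu> * (cmod \<zeta>)\<^sup>2)))"
      by (rule integral_lebesgue_cong_AE) (auto intro: eventually_mono[OF ae])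
    then show ?thesis
      by (simp add: frft_def integral_completion)
  qed
  then have "angular_coeff (frft \<nu> u v f) k \<rho> = angular_coeff (frft \<nu> u v f') k \<rho>"
    by (simp add: angular_coeff_def)
  also have "\<dots> = frac_hankel \<nu> k u v s t (angular_coeff f' k) \<rho>"
    by (rule angular_coeff_frft_borel) (use assms \<rho> f'i in \<open>auto\<close>)
  also have "\<dots> = frac_hankel \<nu> k u v s t (angular_coeff f k) \<rho>"
  proof -
    let ?J = "\<lambda>f r. indicator {0..} r *\<^sub>R (of_real r * angular_coeff f k r *
        bessel_I k (2 * of_real \<nu> * t / (1 - u * v) * of_real r * of_real \<rho>) *
        exp (- of_real \<nu> * (of_real (r\<^sup>2) + u * v * of_real (\<rho>\<^sup>2)) / (1 - u * v)))"
    have m: "?J f' \<in> borel_measurable borel"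
      by (rule borel_measurable_frac_hankel_integrand) (use assms \<rho> f'i in \<open>auto\<close>)
    have "AE r in lborel. ?J f r = ?J f' r"
      using angular_coeff_AE_eq[OF _ ae, of k] AE_lborel_singleton[of 0]
      by (auto simp: indicator_def elim!: eventually_elim2)
    from integral_lebesgue_cong_AE[OF m this] integral_completion[of "?J f'" lborel] m
    show ?thesis
      by (simp add: frac_hankel_def set_lebesgue_integral_def)
  qed
  finally show "angular_coeff (frft \<nu> u v f) k \<rho> = frac_hankel \<nu> k u v s t (angular_coeff f k) \<rho>" .
qed

end
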